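(* For $n\ge1$ let $N=2^n$, $\mathcal{S}_n=\{A+A : A\subseteq \mathbb{F}_2^n\}$ with $A+A=\{a+b:a,b\in A\}$, and $\mathcal{H}_n=\{S\subseteq \mathbb{F}_2^n : \exists\, v\in\mathbb{F}_2^n \text{ with } v^\perp\subseteq S\}$. Then there is a constant $C>0$ such that for all sufficiently large $n$, $$|\mathcal{S}_n\setminus\mathcal{H}_n|\le 2^{-\sqrt N/2^{C\sqrt n}}\,|\mathcal{S}_n|;$$ in particular $|\mathcal{S}_n\setminus\mathcal{H}_n|=o(|\mathcal{S}_n|)$.
   Context: $v^\perp=\{x\in\mathbb{F}_2^n:\langle x,v\rangle=0\}$ with the standard bilinear form over $\mathbb{F}_2$. In $A+A$ the sums $a+a$ are included. (The paper writes the bound as $|\mathcal{S}_n\setminus\mathcal{H}_n| = 2^{-\sqrt N/2^{\Theta(\sqrt n)}}|\mathcal{S}_n|$.) *)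

theory Defs
  imports
    Complex_Main
    "HOL-Library.Z2"
    "HOL-Library.Set_Algebras"
    "HOL-Library.Landau_Symbols"
    "Jordan_Normal_Form.Matrix"
begin

text \<open>\<open>\<F>\<^sub>2\<^sup>n\<close> is \<^term>\<open>carrier_vec n :: bit vec set\<close>, so that \<open>n\<close> can be quantified over;
  \<open>A + A\<close> is the elementwise sum of sets, so it contains the sums \<open>a + a\<close>.\<close>

definition perp :: "nat \<Rightarrow> bit vec \<Rightarrow> bit vec set" where
  "perp n v = {x \<in> carrier_vec n. x \<bullet> v = 0}"

definition sumsets :: "nat \<Rightarrow> bit vec set set" where
  "sumsets n = {A + A | A. A \<subseteq> carrier_vec n}"

text \<open>The vector \<open>v = 0\<close> is allowed; its orthogonal complement is the whole space.\<close>

definition perp_supersets :: "nat \<Rightarrow> bit vec set set" where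
  "perp_supersets n = {S. S \<subseteq> carrier_vec n \<and> (\<exists>v \<in> carrier_vec n. perp n v \<subseteq> S)}"

end

theory Submission
  imports Defs "HOL-Real_Asymp.Real_Asymp"
begin

text \<open>Write \<open>N = 2\<^sup>n\<close>. If \<open>H\<close> is a hyperplane and \<open>B\<close> lies in its complement, then
  \<open>({0} \<union> B) + ({0} \<union> B) = H \<union> B\<close> unless \<open>B + B\<close> misses some \<open>t \<in> H\<close>, so there are at least about
  \<open>2\<^bsup>N/2\<^esup>\<close> sumsets. Consider now \<open>S = A + A\<close> containing no hyperplane.

  If all but \<open>N/(32n)\<close> elements of \<open>A\<close> lie in one coset \<open>D\<close> of a hyperplane \<open>H\<close>, then some nonzero
  \<open>t \<in> H\<close> is missing from \<open>S\<close>, so \<open>A \<inter> D\<close> contains at most one element of each pair \<open>{x, x + t}\<close>.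
  This leaves only \<open>3\<^bsup>N/4\<^esup>\<close> choices for \<open>A \<inter> D\<close>, and few for the rest of \<open>A\<close>.

  Otherwise \<open>A\<close> has a subset \<open>P\<close> of size \<open>n\<^sup>4\<close> that is spread over both cosets of every hyperplane, which is a
  spectral gap for the Cayley graph of \<open>P\<close>. In this graph \<open>A\<close> has no edge to the complement \<open>T\<close> of
  \<open>S\<close>. A small fingerprint \<open>B \<subseteq> A\<close> determines containers \<open>A' \<supseteq> A\<close> and \<open>T' \<supseteq> T\<close> with few edges
  between them, and by expander mixing one of these has size at most \<open>(1/2 - c/n) N\<close>. Since \<open>A\<close> and
  \<open>T\<close> each determine \<open>S\<close>, this leaves at most \<open>2\<^bsup>N/2 - c'N/n\<^esup>\<close> sets \<open>S\<close>.\<close>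

section \<open>Cardinality and characteristic-two arithmetic of the space
  \<open>carrier_vec n\<close>\<close>

lemma bij_betw_Pow_carrier_vec:
  "bij_betw (\<lambda>I. vec n (\<lambda>i. of_bool (i \<in> I) :: bit)) (Pow {..<n}) (carrier_vec n)"
proof (rule bij_betwI[where g = "\<lambda>x. {i. i < n \<and> x $ i = 1}"])
  fix x :: "bit vec" assume "x \<in> carrier_vec n"
  then show "vec n (\<lambda>i. of_bool (i \<in> {i. i < n \<and> x $ i = 1})) = x"
    by (intro eq_vecI) (auto simp: of_bool_def)
qed (auto simp: of_bool_def split: if_splits)

lemma card_bit_vec: "card (carrier_vec n :: bit vec set) = 2 ^ n"
  using bij_betw_same_card[OF bij_betw_Pow_carrier_vec[of n]] by (simp add: card_Pow)

lemma finite_bit_vec [simp]: "finite (carrier_vec n :: bit vec set)"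
  using bij_betw_finite[OF bij_betw_Pow_carrier_vec[of n]] by simp

lemma finite_subset_bit_vec: "A \<subseteq> carrier_vec n \<Longrightarrow> finite (A :: bit vec set)"
  by (rule finite_subset[OF _ finite_bit_vec])

lemma card_subset_bit_vec: "A \<subseteq> carrier_vec n \<Longrightarrow> card (A :: bit vec set) \<le> 2 ^ n"
  using card_mono[OF finite_bit_vec] by (metis card_bit_vec)

lemma bit_vec_add_self: "(x :: bit vec) \<in> carrier_vec n \<Longrightarrow> x + x = 0\<^sub>v n"
proof (intro eq_vecI)
  fix i assume x: "x \<in> carrier_vec n" and i: "i < dim_vec (0\<^sub>v n :: bit vec)"
  then show "(x + x) $ i = 0\<^sub>v n $ i" by (cases "x $ i") auto
qed auto

lemma bit_vec_add_left_self:
  "(x :: bit vec) \<in> carrier_vec n \<Longrightarrow> y \<in> carrier_vec n \<Longrightarrow> x + (x + y) = y"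
  by (metis assoc_add_vec bit_vec_add_self left_zero_vec)

lemma bit_vec_add_right_self:
  "(x :: bit vec) \<in> carrier_vec n \<Longrightarrow> y \<in> carrier_vec n \<Longrightarrow> (x + y) + y = x"
  by (metis assoc_add_vec bit_vec_add_self right_zero_vec)

lemma bit_vec_add_eq_zero_iff:
  "(x :: bit vec) \<in> carrier_vec n \<Longrightarrow> y \<in> carrier_vec n \<Longrightarrow> x + y = 0\<^sub>v n \<longleftrightarrow> x = y"
  by (metis bit_vec_add_left_self bit_vec_add_self right_zero_vec)

lemma set_plus_closed_bit_vec:
  "A \<subseteq> carrier_vec n \<Longrightarrow> B \<subseteq> carrier_vec n \<Longrightarrow> (A :: bit vec set) + B \<subseteq> carrier_vec n"
  by (auto simp: set_plus_def intro!: add_carrier_vec)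

section \<open>Characters, Parseval and expander mixing\<close>

text \<open>The additive character \<open>(-1)^<x,v>\<close> with frequency \<open>v\<close>. It
  takes real values because all characters of this group are real.\<close>

definition chi :: "bit vec \<Rightarrow> bit vec \<Rightarrow> real" where
  "chi v x = (if x \<bullet> v = 0 then 1 else -1)"

lemma chi_cases: "chi v x = 1 \<or> chi v x = -1"
  by (simp add: chi_def)

lemma chi_add:
  "x \<in> carrier_vec n \<Longrightarrow> y \<in> carrier_vec n \<Longrightarrow> v \<in> carrier_vec n
    \<Longrightarrow> chi v (x + y) = chi v x * chi v y"
  by (auto simp: chi_def add_scalar_prod_distrib[of x n y v])

lemma chi_commute: "x \<in> carrier_vec n \<Longrightarrow> v \<in> carrier_vec n \<Longrightarrow> chi v x = chi x v"
  by (simp add: chi_def comm_scalar_prod)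

lemma chi_zero [simp]: "x \<in> carrier_vec n \<Longrightarrow> chi (0\<^sub>v n) x = 1" "v \<in> carrier_vec n \<Longrightarrow> chi v (0\<^sub>v n) = 1"
  by (simp_all add: chi_def)

text \<open>Orthogonality of characters. If coordinate \<open>j\<close> of \<open>x\<close> is 1,
  adding the unit vector of \<open>j\<close> to \<open>v\<close> permutes the frequencies and flips
  every sign, so the sum equals its own negative.\<close>

lemma sum_chi_left:
  assumes x: "x \<in> carrier_vec n"
  shows "(\<Sum>v\<in>carrier_vec n. chi v x) = (if x = 0\<^sub>v n then 2 ^ n else 0)"
proof (cases "x = 0\<^sub>v n")
  case True
  then show ?thesis by (simp add: card_bit_vec)
next
  case False
  then obtain j where j: "j < n" "x $ j = 1"
    using x by (metis bit_not_zero_iff carrier_vecD eq_vecI index_zero_vec)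
  let ?e = "unit_vec n j :: bit vec"
  have e: "?e \<in> carrier_vec n" by simp
  have flip: "chi (?e + v) x = - chi v x" if v: "v \<in> carrier_vec n" for v
    using j x v e by (simp add: chi_commute[OF x] chi_add[OF e v x]) (simp add: chi_def)
  have "(\<Sum>v\<in>carrier_vec n. chi v x) = (\<Sum>v\<in>carrier_vec n. chi (?e + v) x)"
    by (rule sum.reindex_bij_witness[of _ "\<lambda>v. ?e + v" "\<lambda>v. ?e + v"])
      (auto simp: bit_vec_add_left_self[OF e])
  also have "\<dots> = - (\<Sum>v\<in>carrier_vec n. chi v x)"
    by (simp add: flip sum_negf)
  finally show ?thesis using False by simp
qed

lemma sum_chi_right:
  assumes "v \<in> carrier_vec n"
  shows "(\<Sum>x\<in>carrier_vec n. chi v x) = (if v = 0\<^sub>v n then 2 ^ n else 0)"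
  using sum_chi_left[OF assms] by (simp add: chi_commute[OF _ assms])

text \<open>Both cosets of a hyperplane have \<open>N/2\<close> points:
  \<open>(1 + s * chi v x) / 2\<close> is the indicator of the coset, and the character of a nonzero
  frequency sums to 0.\<close>

lemma card_chi_eq:
  assumes v: "v \<in> carrier_vec n" "v \<noteq> 0\<^sub>v n" and s: "s = 1 \<or> s = -1"
  shows "2 * card {x \<in> carrier_vec n. chi v x = s} = 2 ^ n"
proof -
  have chi_of_bool: "1 + s * chi v x = 2 * of_bool (chi v x = s)" for x
    using chi_cases[of v x] s by auto
  have "real (2 * card {x \<in> carrier_vec n. chi v x = s}) = 2 * (\<Sum>x\<in>carrier_vec n. of_bool (chi v x = s))"
    by (simp add: of_bool_def sum.If_cases Int_def)
  also have "\<dots> = (\<Sum>x\<in>carrier_vec n. 1 + s * chi v x)"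
    by (simp add: chi_of_bool sum_distrib_left)
  also have "\<dots> = 2 ^ n"
    using v by (simp add: sum.distrib card_bit_vec sum_chi_right flip: sum_distrib_left)
  finally show ?thesis by (metis of_nat_eq_iff of_nat_numeral of_nat_power)
qed

lemma perp_eq_chi: "perp n v = {x \<in> carrier_vec n. chi v x = 1}"
  by (auto simp: perp_def chi_def)

text \<open>Expanding the square gives characters of \<open>a + b\<close>, and orthogonality keeps
  only the diagonal \<open>a = b\<close>.\<close>

lemma chi_parseval:
  assumes "A \<subseteq> carrier_vec n"
  shows "(\<Sum>v\<in>carrier_vec n. (\<Sum>a\<in>A. chi v a)\<^sup>2) = 2 ^ n * real (card A)"
proof -
  have sub: "a \<in> carrier_vec n" if "a \<in> A" for a using assms that by auto
  have "(\<Sum>v\<in>carrier_vec n. (\<Sum>a\<in>A. chi v a)\<^sup>2)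
      = (\<Sum>v\<in>carrier_vec n. \<Sum>a\<in>A. \<Sum>b\<in>A. chi v (a + b))"
    by (intro sum.cong) (auto simp: power2_eq_square sum_product chi_add[OF sub sub])
  also have "\<dots> = (\<Sum>a\<in>A. \<Sum>b\<in>A. \<Sum>v\<in>carrier_vec n. chi v (a + b))"
    by (subst sum.swap) (intro sum.cong refl sum.swap)
  also have "\<dots> = (\<Sum>a\<in>A. \<Sum>b\<in>A. if a = b then 2 ^ n else 0)"
    by (intro sum.cong refl) (simp add: sub sum_chi_left bit_vec_add_eq_zero_iff[OF sub sub])
  also have "\<dots> = 2 ^ n * real (card A)"
    by (simp add: finite_subset_bit_vec[OF assms])
  finally show ?thesis .
qed

text \<open>Fourier formula for the number of edges from \<open>A\<close> to \<open>C\<close> in the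
  Cayley graph of \<open>P\<close>: orthogonality keeps the triples with
  \<open>a + p + c = 0\<close>, which in characteristic two means \<open>a + p = c\<close>.\<close>

lemma sum_chi_prod3:
  assumes P: "P \<subseteq> carrier_vec n" and A: "A \<subseteq> carrier_vec n" and C: "C \<subseteq> carrier_vec n"
  shows "(\<Sum>v\<in>carrier_vec n. (\<Sum>p\<in>P. chi v p) * (\<Sum>a\<in>A. chi v a) * (\<Sum>c\<in>C. chi v c))
    = 2 ^ n * (\<Sum>a\<in>A. real (card {p \<in> P. a + p \<in> C}))"
proof -
  have sub: "p \<in> P \<Longrightarrow> p \<in> carrier_vec n" "a \<in> A \<Longrightarrow> a \<in> carrier_vec n" "c \<in> C \<Longrightarrow> c \<in> carrier_vec n" for p a c
    using assms by auto
  have fin: "finite P" "finite A" "finite C"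
    using assms by (auto intro: finite_subset_bit_vec)
  have "(\<Sum>v\<in>carrier_vec n. (\<Sum>p\<in>P. chi v p) * (\<Sum>a\<in>A. chi v a) * (\<Sum>c\<in>C. chi v c))
      = (\<Sum>v\<in>carrier_vec n. \<Sum>a\<in>A. \<Sum>p\<in>P. \<Sum>c\<in>C. chi v ((a + p) + c))"
  proof (intro sum.cong refl)
    fix v :: "bit vec" assume v: "v \<in> carrier_vec n"
    have "(\<Sum>p\<in>P. chi v p) * (\<Sum>a\<in>A. chi v a) * (\<Sum>c\<in>C. chi v c)
        = (\<Sum>a\<in>A. chi v a) * ((\<Sum>p\<in>P. chi v p) * (\<Sum>c\<in>C. chi v c))"
      by simp
    also have "\<dots> = (\<Sum>a\<in>A. chi v a * (\<Sum>p\<in>P. \<Sum>c\<in>C. chi v p * chi v c))"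
      unfolding sum_product[of "chi v" P] by (rule sum_distrib_right)
    also have "\<dots> = (\<Sum>a\<in>A. \<Sum>p\<in>P. \<Sum>c\<in>C. chi v a * (chi v p * chi v c))"
      by (simp only: sum_distrib_left)
    also have "\<dots> = (\<Sum>a\<in>A. \<Sum>p\<in>P. \<Sum>c\<in>C. chi v ((a + p) + c))"
      using v sub by (intro sum.cong refl) (simp add: chi_add[of _ n] del: assoc_add_vec)
    finally show "(\<Sum>p\<in>P. chi v p) * (\<Sum>a\<in>A. chi v a) * (\<Sum>c\<in>C. chi v c)
      = (\<Sum>a\<in>A. \<Sum>p\<in>P. \<Sum>c\<in>C. chi v ((a + p) + c))" .
  qed
  also have "\<dots> = (\<Sum>a\<in>A. \<Sum>p\<in>P. \<Sum>c\<in>C. \<Sum>v\<in>carrier_vec n. chi v ((a + p) + c))"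
    by (simp only: sum.swap[where A = "carrier_vec n"])
  also have "\<dots> = (\<Sum>a\<in>A. \<Sum>p\<in>P. \<Sum>c\<in>C. if a + p = c then 2 ^ n else 0)"
    using sub
    by (intro sum.cong refl)
      (simp add: sum_chi_left bit_vec_add_eq_zero_iff[of _ n] del: assoc_add_vec)
  also have "\<dots> = (\<Sum>a\<in>A. \<Sum>p\<in>P. if a + p \<in> C then 2 ^ n else 0)"
    using fin by simp
  also have "\<dots> = 2 ^ n * (\<Sum>a\<in>A. real (card {p \<in> P. a + p \<in> C}))"
    using fin by (simp add: sum.If_cases sum_distrib_left Int_def mult.commute)
  finally show ?thesis .
qed

text \<open>Expander mixing. Frequency 0 gives the main term of the edge count; at every other
  frequency the factor of \<open>P\<close> is at most \<open>L\<close> in absolute value, and the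
  product of the factors of \<open>A\<close> and \<open>C\<close> is bounded by half the sum of
  their squares.\<close>

lemma cayley_mixing:
  assumes P: "P \<subseteq> carrier_vec n" and A: "A \<subseteq> carrier_vec n" and C: "C \<subseteq> carrier_vec n"
    and L: "0 \<le> L" "\<And>v. v \<in> carrier_vec n \<Longrightarrow> v \<noteq> 0\<^sub>v n \<Longrightarrow> \<bar>\<Sum>p\<in>P. chi v p\<bar> \<le> L"
  shows "real (card P) * real (card A) * real (card C) - L * (2 ^ n)\<^sup>2 / 4
    \<le> 2 ^ n * (\<Sum>a\<in>A. real (card {p \<in> P. a + p \<in> C}))"
proof -
  let ?p = "\<lambda>v. \<Sum>p\<in>P. chi v p" and ?a = "\<lambda>v. \<Sum>a\<in>A. chi v a" and ?c = "\<lambda>v. \<Sum>c\<in>C. chi v c"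
  let ?Z = "carrier_vec n - {0\<^sub>v n} :: bit vec set"
  have split0: "sum f (carrier_vec n) = f (0\<^sub>v n) + sum f ?Z" for f :: "bit vec \<Rightarrow> real"
    by (rule sum.remove) auto
  have at0: "(\<Sum>x\<in>X. chi (0\<^sub>v n) x) = real (card X)" if "X \<subseteq> carrier_vec n" for X
  proof -
    have "(\<Sum>x\<in>X. chi (0\<^sub>v n) x) = (\<Sum>x\<in>X. 1)"
      using that by (intro sum.cong) auto
    then show ?thesis by simp
  qed
  \<comment> \<open>Parseval minus the term of frequency 0 leaves \<open>|X| (N - |X|)\<close>,
    which is largest at \<open>|X| = N/2\<close>.\<close>
  have var: "(\<Sum>v\<in>?Z. (\<Sum>x\<in>X. chi v x)\<^sup>2) \<le> (2 ^ n)\<^sup>2 / 4" if X: "X \<subseteq> carrier_vec n" for X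
  proof -
    have "(\<Sum>v\<in>?Z. (\<Sum>x\<in>X. chi v x)\<^sup>2) = 2 ^ n * real (card X) - (real (card X))\<^sup>2"
      using chi_parseval[OF X] split0[of "\<lambda>v. (\<Sum>x\<in>X. chi v x)\<^sup>2"] at0[OF X] by simp
    also have "\<dots> \<le> (2 ^ n)\<^sup>2 / 4"
      using zero_le_power2[of "2 ^ n / 2 - real (card X)"]
      by (simp add: power2_eq_square algebra_simps)
    finally show ?thesis .
  qed
  have "- (L * (2 ^ n)\<^sup>2 / 4) \<le> - (L / 2) * ((\<Sum>v\<in>?Z. (?a v)\<^sup>2) + (\<Sum>v\<in>?Z. (?c v)\<^sup>2))"
    using mult_left_mono[OF add_mono[OF var[OF A] var[OF C]], of "L / 2"] L(1) by simp
  also have "\<dots> = (\<Sum>v\<in>?Z. - (L / 2) * ((?a v)\<^sup>2 + (?c v)\<^sup>2))"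
    by (subst sum_distrib_left[symmetric]) (simp only: sum.distrib)
  also have "\<dots> \<le> (\<Sum>v\<in>?Z. ?p v * ?a v * ?c v)"
  proof (rule sum_mono)
    fix v assume v: "v \<in> ?Z"
    have "2 * \<bar>?a v * ?c v\<bar> \<le> (?a v)\<^sup>2 + (?c v)\<^sup>2"
      using zero_le_power2[of "\<bar>?a v\<bar> - \<bar>?c v\<bar>"] by (simp add: power2_diff abs_mult)
    moreover have "\<bar>?p v * (?a v * ?c v)\<bar> \<le> L * \<bar>?a v * ?c v\<bar>"
      using v L by (simp add: abs_mult mult_right_mono)
    moreover have "L * (2 * \<bar>?a v * ?c v\<bar>) \<le> L * ((?a v)\<^sup>2 + (?c v)\<^sup>2)"
      by (rule mult_left_mono[OF calculation(1) L(1)])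
    ultimately show "- (L / 2) * ((?a v)\<^sup>2 + (?c v)\<^sup>2) \<le> ?p v * ?a v * ?c v"
      by (simp add: mult.assoc)
  qed
  finally show ?thesis
    using sum_chi_prod3[OF P A C] split0[of "\<lambda>v. ?p v * ?a v * ?c v"] at0[OF P] at0[OF A] at0[OF C]
    by simp
qed

section \<open>Sampling and counting of set families\<close>

lemma exists_le_average:
  fixes f :: "'a \<Rightarrow> real"
  assumes "finite A" "A \<noteq> {}" "sum f A \<le> real (card A) * c"
  shows "\<exists>a\<in>A. f a \<le> c"
proof (rule ccontr)
  assume "\<not> (\<exists>a\<in>A. f a \<le> c)"
  then have "(\<Sum>a\<in>A. c) < sum f A"
    using assms(1,2) by (intro sum_strict_mono) auto
  then show False using assms(3) by simp
qed

text \<open>Derandomised sampling: the weight halves in every coordinate \<open>i\<close> whose set \<open>X i\<close> is hit by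
  the next element, and an average choice of that element is good enough.\<close>

lemma exists_subset_hitting:
  fixes X :: "'i \<Rightarrow> 'a set"
  assumes A: "finite A" and I: "finite I" and q: "0 < q"
    and hit: "\<And>i. i \<in> I \<Longrightarrow> q * real (card A) + real k \<le> real (card (A \<inter> X i))"
    and k: "k < card A"
  shows "\<exists>P\<subseteq>A. card P = k \<and>
    (\<Sum>i\<in>I. (1/2) ^ card (P \<inter> X i)) \<le> real (card I) * (1 - q / 2) ^ k"
proof -
  have "\<exists>P\<subseteq>A. card P = j \<and>
    (\<Sum>i\<in>I. (1/2) ^ card (P \<inter> X i)) \<le> real (card I) * (1 - q / 2) ^ j" if "j \<le> k" for j
    using that
  proof (induction j)
    case 0
    show ?case by (rule exI[of _ "{}"]) auto
  next
    case (Suc j)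
    then obtain P where P: "P \<subseteq> A" "card P = j"
      and w: "(\<Sum>i\<in>I. (1/2) ^ card (P \<inter> X i)) \<le> real (card I) * (1 - q / 2) ^ j"
      by auto
    have fP: "finite P" using P(1) A by (rule finite_subset)
    define R where "R = A - P"
    have fR: "finite R" using A by (simp add: R_def)
    have cR: "card R = card A - j"
      using P fP by (simp add: R_def card_Diff_subset)
    have R: "R \<noteq> {}" using cR k Suc.prems by auto
    let ?w = "\<lambda>i. (1/2 :: real) ^ card (P \<inter> X i)"
    have step: "(1/2 :: real) ^ card (insert a P \<inter> X i) = ?w i * (1 - of_bool (a \<in> X i) / 2)"
      if "a \<in> R" for a i
    proof -
      have "insert a P \<inter> X i = (if a \<in> X i then insert a (P \<inter> X i) else P \<inter> X i)" by auto
      then show ?thesis using that fP by (auto simp: R_def card_insert_if)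
    qed
    have "(\<Sum>a\<in>R. \<Sum>i\<in>I. (1/2 :: real) ^ card (insert a P \<inter> X i))
        = (\<Sum>i\<in>I. \<Sum>a\<in>R. ?w i * (1 - of_bool (a \<in> X i) / 2))"
      by (subst sum.swap) (simp add: step)
    also have "\<dots> \<le> (\<Sum>i\<in>I. ?w i * (real (card R) * (1 - q / 2)))"
    proof (rule sum_mono)
      fix i assume i: "i \<in> I"
      \<comment> \<open>Sampling is without replacement. The summand \<open>real k\<close> in
        \<open>hit\<close> pays for the fewer than \<open>k\<close> points already moved to
        \<open>P\<close>.\<close>
      have "A \<inter> X i \<subseteq> (R \<inter> X i) \<union> P" by (auto simp: R_def)
      then have "card (A \<inter> X i) \<le> card (R \<inter> X i) + card P"
        by (meson card_Un_le card_mono fP fR finite_Int finite_UnI le_trans)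
      moreover have "real (card R) \<le> real (card A)" using cR by simp
      ultimately have "q * real (card R) \<le> real (card (R \<inter> X i))"
        using hit[OF i] P(2) Suc.prems mult_left_mono[of "real (card R)" "real (card A)" q] q
        by linarith
      moreover have "(\<Sum>a\<in>R. 1 - of_bool (a \<in> X i) / 2 :: real) = real (card R) - real (card (R \<inter> X i)) / 2"
        using fR by (simp add: sum_subtractf of_bool_def sum.If_cases flip: sum_divide_distrib)
      ultimately have "(\<Sum>a\<in>R. 1 - of_bool (a \<in> X i) / 2 :: real) \<le> real (card R) * (1 - q / 2)"
        by (simp add: algebra_simps)
      then show "(\<Sum>a\<in>R. ?w i * (1 - of_bool (a \<in> X i) / 2)) \<le> ?w i * (real (card R) * (1 - q / 2))"
        by (subst sum_distrib_left[symmetric]) (rule mult_left_mono, auto)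
    qed
    also have "\<dots> = real (card R) * ((1 - q / 2) * (\<Sum>i\<in>I. ?w i))"
      by (simp add: sum_distrib_left sum_distrib_right mult_ac)
    finally obtain a where a: "a \<in> R"
      and le: "(\<Sum>i\<in>I. (1/2 :: real) ^ card (insert a P \<inter> X i)) \<le> (1 - q / 2) * (\<Sum>i\<in>I. ?w i)"
      using exists_le_average[OF fR R] by blast
    have "(1 - q / 2) * (\<Sum>i\<in>I. ?w i) \<le> (1 - q / 2) * (real (card I) * (1 - q / 2) ^ j)"
    \<comment> \<open>The bound \<open>q \<le> 1\<close> comes from \<open>hit\<close>, which needs
      an index; for empty \<open>I\<close> both sides are 0.\<close>
    proof (cases "I = {}")
      case False
      then obtain i where i: "i \<in> I" by auto
      have "q * real (card A) \<le> real (card A)"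
        using hit[OF i] card_mono[OF A, of "A \<inter> X i"] by simp
      then have "q \<le> 1" using k by simp
      then show ?thesis using w by (intro mult_left_mono) auto
    qed simp
    with le a P fP show ?case
      by (intro exI[of _ "insert a P"]) (auto simp: R_def mult_ac)
  qed
  then show ?thesis by blast
qed

text \<open>By induction: a nonempty set of size at most \<open>m + 1\<close> arises by inserting a
  point into a set of size at most \<open>m\<close>, so each step costs a factor of at most
  \<open>card X + 1\<close>.\<close>

lemma card_small_subsets_le:
  assumes "finite X"
  shows "card {B. B \<subseteq> X \<and> card B \<le> m} \<le> (card X + 1) ^ m"
proof (induction m)
  case 0
  have "{B. B \<subseteq> X \<and> card B \<le> 0} \<subseteq> {{}}"
    using assms by (auto dest: finite_subset)
  then show ?case using card_mono[of "{{} :: 'a set}"] by (metis card_1_singleton_iff finite.emptyI finite.insertI One_nat_def power_0)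
next
  case (Suc m)
  let ?S = "\<lambda>m. {B. B \<subseteq> X \<and> card B \<le> m}"
  have fin: "finite (?S m)" for m using assms by simp
  have "?S (Suc m) \<subseteq> ?S m \<union> (\<lambda>(x, B). insert x B) ` (X \<times> ?S m)"
  proof
    fix B assume B: "B \<in> ?S (Suc m)"
    show "B \<in> ?S m \<union> (\<lambda>(x, B). insert x B) ` (X \<times> ?S m)"
    proof (cases "B = {}")
      case False
      then obtain x where x: "x \<in> B" by auto
      have "finite B" using B assms by (auto dest: finite_subset)
      then have "(x, B - {x}) \<in> X \<times> ?S m" using B x by auto
      moreover have "B = insert x (B - {x})" using x by auto
      ultimately show ?thesis by (auto intro!: image_eqI[of _ _ "(x, B - {x})"])
    qed auto
  qed
  then have "card (?S (Suc m)) \<le> card (?S m \<union> (\<lambda>(x, B). insert x B) ` (X \<times> ?S m))"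
    using fin assms by (intro card_mono) auto
  also have "\<dots> \<le> card (?S m) + card (X \<times> ?S m)"
    using fin assms by (intro order.trans[OF card_Un_le] add_left_mono card_image_le) auto
  also have "\<dots> = (card X + 1) * card (?S m)" by (simp add: card_cartesian_product)
  also have "\<dots> \<le> (card X + 1) ^ Suc m" by (simp only: power_Suc mult_le_mono2 Suc.IH)
  finally show ?case .
qed

text \<open>\<open>D\<close> splits into pairs \<open>{x, \<sigma> x}\<close>, and an admissible set
  meets each pair in one of three ways: a factor 3 for every two points. Squaring avoids halving
  \<open>card D\<close>.\<close>

lemma card_involution_free_le:
  assumes "finite D" "\<And>x. x \<in> D \<Longrightarrow> \<sigma> x \<in> D \<and> \<sigma> x \<noteq> x \<and> \<sigma> (\<sigma> x) = x"
  shows "(card {B. B \<subseteq> D \<and> (\<forall>x\<in>B. \<sigma> x \<notin> B)})\<^sup>2 \<le> 3 ^ card D"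
  using assms
proof (induction D rule: finite_psubset_induct)
  case (psubset D)
  let ?S = "\<lambda>D. {B. B \<subseteq> D \<and> (\<forall>x\<in>B. \<sigma> x \<notin> B)}"
  show ?case
  proof (cases "D = {}")
    case True
    have "?S {} = {{}}" by auto
    then show ?thesis using True by simp
  next
    case False
    then obtain x where x: "x \<in> D" by auto
    define E where "E = D - {x, \<sigma> x}"
    have s: "\<sigma> x \<in> D" "\<sigma> x \<noteq> x" "\<sigma> (\<sigma> x) = x" using psubset.prems x by auto
    have E: "E \<subset> D" "finite E" using x psubset.hyps(1) by (auto simp: E_def)
    have "card D = card E + card {x, \<sigma> x}"
      using x s psubset.hyps(1) card_mono[of D "{x, \<sigma> x}"] by (simp add: E_def card_Diff_subset)
    then have cD: "card D = card E + 2" using s by simp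
    have Einv: "\<sigma> y \<in> E \<and> \<sigma> y \<noteq> y \<and> \<sigma> (\<sigma> y) = y" if "y \<in> E" for y
    proof -
      have y: "y \<in> D" "y \<noteq> x" "y \<noteq> \<sigma> x" using that by (auto simp: E_def)
      then show ?thesis using psubset.prems[OF y(1)] s(3) by (auto simp: E_def)
    qed
    have IH: "(card (?S E))\<^sup>2 \<le> 3 ^ card E"
      using psubset.IH[OF E(1) Einv] by blast
    let ?T = "{{}, {x}, {\<sigma> x}}"
    have "?S D \<subseteq> (\<lambda>(B, U). B \<union> U) ` (?S E \<times> ?T)"
    proof
      fix B assume B: "B \<in> ?S D"
      have "B \<inter> {x, \<sigma> x} \<in> ?T" using B s by auto
      moreover have "B \<inter> E \<in> ?S E" using B by auto
      moreover have "B = (B \<inter> E) \<union> (B \<inter> {x, \<sigma> x})" using B by (auto simp: E_def)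
      ultimately show "B \<in> (\<lambda>(B, U). B \<union> U) ` (?S E \<times> ?T)"
        by (intro image_eqI[of _ _ "(B \<inter> E, B \<inter> {x, \<sigma> x})"]) auto
    qed
    then have "card (?S D) \<le> card (?S E \<times> ?T)"
      using E(2) by (intro surj_card_le) auto
    also have "\<dots> \<le> card (?S E) * 3"
      by (auto simp: card_cartesian_product card_insert_if intro!: mult_le_mono2)
    finally have "(card (?S D))\<^sup>2 \<le> (card (?S E) * 3)\<^sup>2"
      by (rule power_mono) simp
    also have "\<dots> \<le> 3 ^ card D"
      using IH by (simp add: cD power_mult_distrib)
    finally show ?thesis .
  qed
qed

section \<open>Fingerprints, spectral gap and containers\<close>

text \<open>Take \<open>B\<close> of maximal size among the subsets whose points contribute on
  average at least \<open>\<theta> |P|\<close> sums to \<open>B + P\<close>. A point of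
  \<open>A\<close> with more than \<open>\<theta> |P|\<close> sums outside \<open>B + P\<close>
  could be inserted, contradicting maximality. Since \<open>|B + P| \<le> N\<close>, the set
  \<open>B\<close> is small when \<open>\<theta> |P|\<close> is large.\<close>

lemma exists_fingerprint:
  fixes A P :: "bit vec set" and \<theta> :: real
  assumes A: "A \<subseteq> carrier_vec n" and P: "P \<subseteq> carrier_vec n" and \<theta>: "0 \<le> \<theta>"
  shows "\<exists>B\<subseteq>A. \<theta> * real (card P) * real (card B) \<le> real (card (B + P)) \<and>
    (\<forall>a\<in>A. real (card {p \<in> P. a + p \<notin> B + P}) \<le> \<theta> * real (card P))"
proof -
  let ?Q = "\<lambda>B. B \<subseteq> A \<and> \<theta> * real (card P) * real (card B) \<le> real (card (B + P))"
  have fin: "finite A" "finite P" using A P by (auto intro: finite_subset_bit_vec)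
  have "?Q {}" by (simp add: set_plus_def)
  moreover have "\<forall>B. ?Q B \<longrightarrow> card B < Suc (card A)" using fin card_mono by (auto simp: less_Suc_eq_le)
  ultimately have "\<exists>B. ?Q B \<and> (\<forall>B'. ?Q B' \<longrightarrow> card B' \<le> card B)"
    by (rule ex_has_greatest_nat)
  then obtain B where B: "?Q B" and max: "\<And>B'. ?Q B' \<Longrightarrow> card B' \<le> card B"
    by auto
  have fB: "finite B" using B fin by (auto dest: finite_subset)
  have "real (card {p \<in> P. a + p \<notin> B + P}) \<le> \<theta> * real (card P)" if a: "a \<in> A" for a
  proof (rule ccontr)
    let ?N = "{p \<in> P. a + p \<notin> B + P}"
    assume *: "\<not> real (card ?N) \<le> \<theta> * real (card P)"
    have aB: "a \<notin> B"
    proof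
      assume "a \<in> B"
      then have "?N = {}" by (auto simp: set_plus_def)
      then have "real (card ?N) = 0" by (simp only: card.empty of_nat_0)
      moreover have "0 \<le> \<theta> * real (card P)" using \<theta> by simp
      ultimately show False using * by linarith
    qed
    have inj: "inj_on (\<lambda>p. a + p) ?N"
      using a A P by (intro inj_onI) (metis (no_types, lifting) bit_vec_add_left_self mem_Collect_eq subsetD)
    have "(B + P) \<union> (\<lambda>p. a + p) ` ?N \<subseteq> insert a B + P"
      by (auto simp: set_plus_def)
    then have "card ((B + P) \<union> (\<lambda>p. a + p) ` ?N) \<le> card (insert a B + P)"
      using fB fin by (intro card_mono finite_set_plus) auto
    moreover have "card ((B + P) \<union> (\<lambda>p. a + p) ` ?N) = card (B + P) + card ?N"
      using fB fin by (subst card_Un_disjoint) (auto simp: card_image[OF inj] intro: finite_set_plus)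
    ultimately have "real (card (B + P)) + real (card ?N) \<le> real (card (insert a B + P))"
      by linarith
    then have "?Q (insert a B)"
      using B a * aB fB by (auto simp: algebra_simps)
    then have "card (insert a B) \<le> card B" by (rule max)
    then show False using aB fB by simp
  qed
  then show ?thesis using B by blast
qed

text \<open>Every hyperplane coset misses a positive proportion of \<open>P\<close>, which is a spectral gap of the
  Cayley graph of \<open>P\<close>.\<close>

lemma exists_spectral_gap_subset:
  assumes n: "0 < n" and A: "A \<subseteq> carrier_vec n"
    and spread: "\<And>v s. v \<in> carrier_vec n \<Longrightarrow> v \<noteq> 0\<^sub>v n \<Longrightarrow> s = 1 \<or> s = -1
      \<Longrightarrow> 2 ^ n < 32 * n * card {a \<in> A. chi v a = s}"
    and k: "64 * n * k \<le> 2 ^ n" "256 * n * (n + 1) \<le> k"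
  shows "\<exists>P\<subseteq>A. card P = k \<and> (\<forall>v\<in>carrier_vec n - {0\<^sub>v n}.
    \<bar>\<Sum>p\<in>P. chi v p\<bar> \<le> real k * (1 - 1 / (128 * real n)))"
proof -
  define I :: "(bit vec \<times> real) set" where "I = (carrier_vec n - {0\<^sub>v n}) \<times> {1, -1}"
  define X where "X = (\<lambda>(v, s). {x. chi v x = s})"
  \<comment> \<open>Half of the density \<open>1/(32 n)\<close> given by \<open>spread\<close>; the
    other half absorbs \<open>k\<close> in the hypothesis of
    \<open>exists_subset_hitting\<close>.\<close>
  define q where "q = 1 / (64 * real n)"
  have finI: "finite I" by (simp add: I_def)
  have cardI: "card I \<le> 2 * 2 ^ n"
    using card_subset_bit_vec[of "carrier_vec n - {0\<^sub>v n}" n]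
    by (simp add: I_def card_cartesian_product)
  have finA: "finite A" using A by (rule finite_subset_bit_vec)
  have q: "0 < q" using n by (simp add: q_def)
  have cardA: "real (card A) \<le> 2 ^ n"
    using card_subset_bit_vec[OF A] by (metis of_nat_le_iff of_nat_numeral of_nat_power)
  have k': "real k \<le> q * 2 ^ n"
  proof -
    have "real (64 * n * k) \<le> 2 ^ n"
      using k(1) by (metis of_nat_le_iff of_nat_numeral of_nat_power)
    then show ?thesis using n by (simp add: q_def field_simps)
  qed
  have large: "2 * (q * 2 ^ n) < real (card (A \<inter> X i))" if i: "i \<in> I" for i
  proof -
    obtain v s where vs: "i = (v, s)" "v \<in> carrier_vec n" "v \<noteq> 0\<^sub>v n" "s = 1 \<or> s = -1"
      using i by (auto simp: I_def)
    have "2 ^ n < real (32 * n * card {a \<in> A. chi v a = s})"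
      using spread[OF vs(2-4)] by (metis of_nat_less_iff of_nat_numeral of_nat_power)
    moreover have "A \<inter> X i = {a \<in> A. chi v a = s}" by (auto simp: vs X_def)
    ultimately show ?thesis using n by (simp add: q_def field_simps)
  qed
  have hit: "q * real (card A) + real k \<le> real (card (A \<inter> X i))" if "i \<in> I" for i
    using large[OF that] k' mult_left_mono[OF cardA, of q] q by linarith
  have kA: "k < card A"
  proof -
    have "(unit_vec n 0, 1) \<in> I" using n by (auto simp: I_def)
    from large[OF this] have "2 * (q * 2 ^ n) < real (card A)"
      using card_mono[OF finA, of "A \<inter> X (unit_vec n 0, 1)"] by simp
    moreover have "0 < q * 2 ^ n" using q by simp
    ultimately have "real k < real (card A)" using k' by linarith
    then show ?thesis by (simp only: of_nat_less_iff)
  qed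
  have "\<exists>P\<subseteq>A. card P = k \<and>
      (\<Sum>i\<in>I. (1/2) ^ card (P \<inter> X i)) \<le> real (card I) * (1 - q / 2) ^ k"
    using finA finI q hit kA by (rule exists_subset_hitting)
  then obtain P where P: "P \<subseteq> A" "card P = k"
    and w: "(\<Sum>i\<in>I. (1/2 :: real) ^ card (P \<inter> X i)) \<le> real (card I) * (1 - q / 2) ^ k"
    by auto
  have finP: "finite P" using P finA by (auto dest: finite_subset)
  have q1: "q \<le> 1" using n by (simp add: q_def)
  have hits: "real k / (256 * real n) \<le> real (card (P \<inter> X i))" if i: "i \<in> I" for i
  proof -
    \<comment> \<open>A single term is at most the total weight, so
      \<open>2^(-|P \<inter> X i|) \<le> 2^(n + 1 - q k / 2)\<close>. Half of
      \<open>q k / 2 = k/(128 n)\<close> then pays for \<open>n + 1\<close>.\<close>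
    have "2 powr (- real (card (P \<inter> X i))) = (1/2 :: real) ^ card (P \<inter> X i)"
      by (simp add: powr_minus powr_realpow power_one_over inverse_eq_divide)
    also have "\<dots> \<le> (\<Sum>i\<in>I. (1/2 :: real) ^ card (P \<inter> X i))"
      using i finI by (intro member_le_sum) auto
    also have "\<dots> \<le> real (card I) * (1 - q / 2) ^ k" by (rule w)
    also have "\<dots> \<le> (2 * 2 ^ n) * (1 - q / 2) ^ k"
    proof (rule mult_right_mono)
      show "real (card I) \<le> 2 * 2 ^ n"
        using of_nat_mono[OF cardI, where 'a = real] by simp
    qed (use q1 in auto)
    also have "(1 - q / 2) ^ k \<le> exp (- (q / 2)) ^ k"
      using q1 exp_ge_add_one_self[of "- (q / 2)"] by (intro power_mono) auto
    also have "exp (- (q / 2)) ^ k = exp (- (q / 2 * real k))"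
      by (simp add: exp_of_nat_mult[symmetric] mult.commute)
    also have "\<dots> \<le> 2 powr (- (q / 2 * real k))"
      using q ln_2_less_1 by (simp add: powr_def mult_left_le)
    also have "2 * 2 ^ n = 2 powr (real n + 1)"
      by (simp add: powr_add powr_realpow)
    also have "2 powr (real n + 1) * 2 powr (- (q / 2 * real k)) = 2 powr (real n + 1 - q / 2 * real k)"
      by (simp flip: powr_add)
    finally have "q / 2 * real k - (real n + 1) \<le> real (card (P \<inter> X i))"
      by simp
    moreover have "real n + 1 \<le> real k / (256 * real n)"
    proof -
      have "real (256 * n * (n + 1)) \<le> real k" using k(2) by (simp only: of_nat_le_iff)
      then show ?thesis using n by (simp add: field_simps)
    qed
    moreover have "q / 2 * real k = 2 * (real k / (256 * real n))" by (simp add: q_def)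
    ultimately show ?thesis by linarith
  qed
  have "\<bar>\<Sum>p\<in>P. chi v p\<bar> \<le> real k * (1 - 1 / (128 * real n))"
    if v: "v \<in> carrier_vec n - {0\<^sub>v n}" for v
  proof -
    let ?p = "card (P \<inter> X (v, 1))" and ?m = "card (P \<inter> X (v, -1))"
    have "P = (P \<inter> X (v, 1)) \<union> (P \<inter> X (v, -1))" "(P \<inter> X (v, 1)) \<inter> (P \<inter> X (v, -1)) = {}"
      using chi_cases by (auto simp: X_def)
    then have sum_split: "sum f P = sum f (P \<inter> X (v, 1)) + sum f (P \<inter> X (v, -1))" for f :: "bit vec \<Rightarrow> real"
      using finP by (metis finite_Int sum.union_disjoint)
    have "(\<Sum>p\<in>P. chi v p) = real ?p - real ?m"
      unfolding sum_split by (simp add: X_def)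
    moreover have "real k = real ?p + real ?m"
      using sum_split[of "\<lambda>_. 1"] P by simp
    \<comment> \<open>Each coset takes at least \<open>k/(256 n)\<close> of the \<open>k\<close>
      points, so the two counts differ by at most \<open>k - 2 k/(256 n)\<close>.\<close>
    moreover have "real k / (256 * real n) \<le> real ?p" "real k / (256 * real n) \<le> real ?m"
      using v by (auto intro!: hits simp: I_def)
    moreover have "real k * (1 - 1 / (128 * real n)) = real k - 2 * (real k / (256 * real n))"
      by (simp add: algebra_simps)
    ultimately show ?thesis by linarith
  qed
  with P show ?thesis by blast
qed

text \<open>For a fingerprint \<open>B\<close> of \<open>A\<close>, \<open>diff_container\<close> holds the complement of \<open>A + A\<close> and
  \<open>set_container\<close> holds \<open>A\<close> itself.\<close>

definition diff_container :: "nat \<Rightarrow> bit vec set \<Rightarrow> bit vec set \<Rightarrow> bit vec set" where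
  "diff_container n P B = carrier_vec n - (B + P)"

definition set_container :: "nat \<Rightarrow> real \<Rightarrow> bit vec set \<Rightarrow> bit vec set \<Rightarrow> bit vec set" where
  "set_container n g P B =
    {a \<in> carrier_vec n. real (card {p \<in> P. a + p \<in> diff_container n P B}) \<le> g * real (card P)}"

text \<open>A fingerprint with \<open>\<theta> = g\<close> makes the edges between the two
  containers sparse: every point of \<open>set_container\<close> has at most \<open>g |P|\<close> of
  them. Mixing with \<open>L = |P| (1 - 16 g)\<close> then prevents both containers from being
  nearly half of the space.\<close>

lemma exists_containers:
  assumes A: "A \<subseteq> carrier_vec n" and P: "P \<subseteq> A" "0 < card P" and g: "0 < g" "g \<le> 1 / 16"
    and gap: "\<And>v. v \<in> carrier_vec n \<Longrightarrow> v \<noteq> 0\<^sub>v n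
      \<Longrightarrow> \<bar>\<Sum>p\<in>P. chi v p\<bar> \<le> real (card P) * (1 - 16 * g)"
  shows "\<exists>B\<subseteq>A. g * real (card P) * real (card B) \<le> 2 ^ n \<and>
    A \<subseteq> set_container n g P B \<and> carrier_vec n - (A + A) \<subseteq> diff_container n P B \<and>
    (real (card (set_container n g P B)) \<le> (1 / 2 - 2 * g) * 2 ^ n \<or>
     real (card (diff_container n P B)) \<le> (1 / 2 - 2 * g) * 2 ^ n)"
proof -
  have PG: "P \<subseteq> carrier_vec n" using P A by simp
  obtain B where B: "B \<subseteq> A" "g * real (card P) * real (card B) \<le> real (card (B + P))"
    and deg: "\<And>a. a \<in> A \<Longrightarrow> real (card {p \<in> P. a + p \<notin> B + P}) \<le> g * real (card P)"
    using exists_fingerprint[OF A PG, of g] g by force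
  have BG: "B \<subseteq> carrier_vec n" using B A by simp
  let ?A = "set_container n g P B" and ?C = "diff_container n P B"
  have "card (B + P) \<le> 2 ^ n"
    using set_plus_closed_bit_vec[OF BG PG] by (rule card_subset_bit_vec)
  then have "real (card (B + P)) \<le> 2 ^ n"
    by (metis of_nat_le_iff of_nat_numeral of_nat_power)
  then have size: "g * real (card P) * real (card B) \<le> 2 ^ n" using B by linarith
  have AA: "A \<subseteq> ?A"
  proof
    fix a assume a: "a \<in> A"
    then have "{p \<in> P. a + p \<in> ?C} = {p \<in> P. a + p \<notin> B + P}"
      using A PG by (auto simp: diff_container_def intro!: add_carrier_vec)
    then show "a \<in> ?A" using deg[OF a] a A by (auto simp: set_container_def)
  qed
  have "B + P \<subseteq> A + A" using B P by (intro set_plus_mono2)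
  then have CC: "carrier_vec n - (A + A) \<subseteq> ?C" by (auto simp: diff_container_def)
  have sub: "?A \<subseteq> carrier_vec n" "?C \<subseteq> carrier_vec n"
    by (auto simp: set_container_def diff_container_def)
  have "real (card ?A) \<le> (1 / 2 - 2 * g) * 2 ^ n \<or> real (card ?C) \<le> (1 / 2 - 2 * g) * 2 ^ n"
  proof (rule ccontr)
    assume "\<not> ?thesis"
    then have big: "(1 / 2 - 2 * g) * 2 ^ n \<le> real (card ?A)" "(1 / 2 - 2 * g) * 2 ^ n \<le> real (card ?C)"
      by auto
    define N :: real where "N = 2 ^ n"
    define k where "k = real (card P)"
    have N: "0 < N" and k: "0 < k" using P by (auto simp: N_def k_def)
    have "real (card P) * real (card ?A) * real (card ?C) - real (card P) * (1 - 16 * g) * (2 ^ n)\<^sup>2 / 4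
        \<le> 2 ^ n * (\<Sum>a\<in>?A. real (card {p \<in> P. a + p \<in> ?C}))"
      using g gap by (intro cayley_mixing[OF PG sub]) auto
    also have "\<dots> \<le> 2 ^ n * (\<Sum>a\<in>?A. g * real (card P))"
      by (intro mult_left_mono sum_mono) (auto simp: set_container_def)
    also have "\<dots> \<le> 2 ^ n * (2 ^ n * (g * real (card P)))"
    proof -
      have "real (card ?A) \<le> 2 ^ n"
        using card_subset_bit_vec[OF sub(1)] by (metis of_nat_le_iff of_nat_numeral of_nat_power)
      then show ?thesis using g by (simp add: mult_right_mono)
    qed
    finally have 1: "k * (real (card ?A) * real (card ?C)) \<le> k * (N\<^sup>2 * (g + (1 - 16 * g) / 4))"
      by (simp add: N_def k_def power2_eq_square algebra_simps)
    have "((1 / 2 - 2 * g) * N) * ((1 / 2 - 2 * g) * N) \<le> real (card ?A) * real (card ?C)"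
      using big g by (intro mult_mono) (auto simp: N_def)
    also have "\<dots> \<le> N\<^sup>2 * (g + (1 - 16 * g) / 4)"
      using 1 k by (simp only: mult_le_cancel_left_pos)
    finally have "N\<^sup>2 * (1 / 2 - 2 * g)\<^sup>2 \<le> N\<^sup>2 * (g + (1 - 16 * g) / 4)"
      by (simp add: power2_eq_square mult_ac)
    then have "(1 / 2 - 2 * g)\<^sup>2 \<le> g + (1 - 16 * g) / 4"
      using N by (simp add: mult_le_cancel_left_pos)
    moreover have "(1 / 2 - 2 * g)\<^sup>2 = 1 / 4 - 2 * g + 4 * g\<^sup>2"
      by (simp add: power2_eq_square algebra_simps)
    ultimately have "1 / 4 - 2 * g + 4 * g\<^sup>2 \<le> g + (1 - 16 * g) / 4" by simp
    moreover have "g + (1 - 16 * g) / 4 = 1 / 4 - 3 * g" by (simp add: field_simps)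
    moreover have "0 \<le> g\<^sup>2" by simp
    \<comment> \<open>Two large containers would give
      \<open>1/4 - 2 g + 4 g^2 \<le> 1/4 - 3 g\<close>, impossible for \<open>g > 0\<close>.\<close>
    ultimately show False using g by linarith
  qed
  with B(1) size AA CC show ?thesis by blast
qed

lemma card_UN_le_real:
  assumes "finite I" "\<And>i. i \<in> I \<Longrightarrow> real (card (f i)) \<le> c" "real (card I) \<le> d" "0 \<le> c"
  shows "real (card (\<Union>i\<in>I. f i)) \<le> d * c"
proof -
  have "real (card (\<Union>i\<in>I. f i)) \<le> (\<Sum>i\<in>I. real (card (f i)))"
    using card_UN_le[OF assms(1), of f] by (simp flip: of_nat_sum)
  also have "\<dots> \<le> real (card I) * c"
    using sum_mono[of I "\<lambda>i. real (card (f i))" "\<lambda>_. c"] assms by simp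
  also have "\<dots> \<le> d * c" using assms by (intro mult_right_mono) auto
  finally show ?thesis .
qed

lemma card_Pow_le_powr:
  assumes "real (card X) \<le> c" shows "real (card (Pow X)) \<le> 2 powr c"
proof (cases "finite X")
  case True
  then show ?thesis using assms by (simp add: card_Pow flip: powr_realpow)
\<comment> \<open>For infinite \<open>X\<close> also \<open>Pow X\<close> is infinite, and its
  \<open>card\<close> is 0.\<close>
qed simp

section \<open>Upper bound for sumsets of spread sets\<close>

text \<open>The first two factors count the choices of \<open>P\<close> and \<open>B\<close>. Given
  these, \<open>S\<close> is determined either by \<open>A\<close> inside
  \<open>set_container\<close> or by the complement of \<open>S\<close> inside
  \<open>diff_container\<close>; one of the two containers is small, hence the factor 2 and the
  power of two.\<close>

lemma card_spread_sumsets_le: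
  assumes n: "0 < n" and k: "64 * n * k \<le> 2 ^ n" "256 * n * (n + 1) \<le> k"
  shows "real (card {A + A | A. A \<subseteq> carrier_vec n \<and> (\<forall>v\<in>carrier_vec n - {0\<^sub>v n}. \<forall>s\<in>{1, -1}.
      2 ^ n < 32 * n * card {a \<in> A. chi v a = s})})
    \<le> real ((2 ^ n + 1) ^ k) * (real ((2 ^ n + 1) ^ (2048 * n * 2 ^ n div k))
      * (2 * 2 powr ((1 / 2 - 1 / (1024 * real n)) * 2 ^ n)))"
    (is "real (card ?S) \<le> _")
proof -
  \<comment> \<open>Chosen so that \<open>16 * g\<close> is the spectral gap
    \<open>1 / (128 * real n)\<close>.\<close>
  define g where "g = 1 / (2048 * real n)"
  define c :: real where "c = (1 / 2 - 1 / (1024 * real n)) * 2 ^ n"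
  have g: "0 < g" "g \<le> 1 / 16" using n by (auto simp: g_def field_simps)
  have gc: "(1 / 2 - 2 * g) * 2 ^ n = c" by (simp add: g_def c_def)
  define small :: "nat \<Rightarrow> bit vec set set" where "small m = {B. B \<subseteq> carrier_vec n \<and> card B \<le> m}" for m
  have fin_small: "finite (small m)" for m by (simp add: small_def)
  have card_small: "real (card (small m)) \<le> real ((2 ^ n + 1) ^ m)" for m
    using card_small_subsets_le[of "carrier_vec n :: bit vec set" m] 
    unfolding small_def card_bit_vec of_nat_le_iff by simp
  \<comment> \<open>Maximal fingerprint size, from
    \<open>g * k * card B \<le> 2 ^ n\<close>.\<close>
  define m where "m = 2048 * n * 2 ^ n div k"
  \<comment> \<open>\<open>U\<close> and \<open>W\<close> are empty for an oversized container, so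
    their size bounds hold for all pairs \<open>P\<close>, \<open>B\<close>.\<close>
  define U where "U P B = (\<lambda>A. A + A) ` (if real (card (set_container n g P B)) \<le> c then Pow (set_container n g P B) else {})" for P B
  define W where "W P B = (\<lambda>T. carrier_vec n - T) ` (if real (card (diff_container n P B)) \<le> c then Pow (diff_container n P B) else {})" for P B
  have k0: "0 < k" using n k(2) by (cases k) auto
  have "?S \<subseteq> (\<Union>P\<in>small k. \<Union>B\<in>small m. U P B \<union> W P B)"
  proof
    fix S assume "S \<in> ?S"
    then obtain A where A: "A \<subseteq> carrier_vec n" "S = A + A"
      and spread: "\<And>v s. v \<in> carrier_vec n \<Longrightarrow> v \<noteq> 0\<^sub>v n \<Longrightarrow> s = 1 \<or> s = -1
        \<Longrightarrow> 2 ^ n < 32 * n * card {a \<in> A. chi v a = s}"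
      by auto
    obtain P where P: "P \<subseteq> A" "card P = k"
      and gap: "\<forall>v\<in>carrier_vec n - {0\<^sub>v n}. \<bar>\<Sum>p\<in>P. chi v p\<bar> \<le> real k * (1 - 1 / (128 * real n))"
      using exists_spectral_gap_subset[OF n A(1) spread k] by blast
    have "\<bar>\<Sum>p\<in>P. chi v p\<bar> \<le> real (card P) * (1 - 16 * g)"
      if "v \<in> carrier_vec n" "v \<noteq> 0\<^sub>v n" for v
      using gap that P(2) by (simp add: g_def)
    with exists_containers[OF A(1) P(1) _ g] P(2) k0 obtain B where B: "B \<subseteq> A"
      "g * real k * real (card B) \<le> 2 ^ n" "A \<subseteq> set_container n g P B"
      "carrier_vec n - (A + A) \<subseteq> diff_container n P B"
      and alt: "real (card (set_container n g P B)) \<le> c \<or> real (card (diff_container n P B)) \<le> c"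
      unfolding gc by metis
    have "real (card B * k) \<le> real (2048 * n * 2 ^ n)"
      using B(2) n by (simp add: g_def field_simps)
    then have "card B \<le> m"
      unfolding of_nat_le_iff m_def using k0 by (simp add: less_eq_div_iff_mult_less_eq)
    then have mem: "P \<in> small k" "B \<in> small m" using P B(1) A(1) by (auto simp: small_def)
    from alt have "S \<in> U P B \<union> W P B"
    proof
      assume "real (card (set_container n g P B)) \<le> c"
      then show ?thesis using B(3) A(2) by (auto simp: U_def)
    next
      assume le: "real (card (diff_container n P B)) \<le> c"
      have "S = carrier_vec n - (carrier_vec n - (A + A))"
        using set_plus_closed_bit_vec[OF A(1) A(1)] A(2) by auto
      then show ?thesis using B(4) le by (auto simp: W_def)
    qed
    with mem show "S \<in> (\<Union>P\<in>small k. \<Union>B\<in>small m. U P B \<union> W P B)" by blast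
  qed
  moreover have finUW: "finite (U P B)" "finite (W P B)" for P B
    using finite_subset_bit_vec[of "set_container n g P B" n] finite_subset_bit_vec[of "diff_container n P B" n]
    by (auto simp: U_def W_def set_container_def diff_container_def)
  ultimately have "real (card ?S) \<le> real (card (\<Union>P\<in>small k. \<Union>B\<in>small m. U P B \<union> W P B))"
    using fin_small by (intro of_nat_mono card_mono) auto
  also have "\<dots> \<le> real ((2 ^ n + 1) ^ k) * (real ((2 ^ n + 1) ^ m) * (2 * 2 powr c))"
  proof (intro card_UN_le_real fin_small card_small)
    fix P B
    have "real (card (U P B)) \<le> 2 powr c" "real (card (W P B)) \<le> 2 powr c"
      unfolding U_def W_def
      by (rule order.trans[OF of_nat_mono[OF card_image_le]],
        auto intro!: card_Pow_le_powr finite_subset_bit_vec[of _ n] simp del: card_Pow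
          simp: set_container_def diff_container_def)+
    then show "real (card (U P B \<union> W P B)) \<le> 2 * 2 powr c"
      using of_nat_mono[OF card_Un_le[of "U P B" "W P B"], where 'a = real] by simp
  qed auto
  finally show ?thesis by (simp only: m_def c_def)
qed

section \<open>Upper bound for sumsets of sets concentrated on one coset\<close>

text \<open>For \<open>D\<close> and \<open>t\<close> in the space these are the subsets
  \<open>B\<close> of \<open>D\<close> with \<open>t\<close> missing from \<open>B + B\<close>; the
  pointwise form fits the involution \<open>x \<mapsto> t + x\<close>.\<close>

definition shift_free :: "bit vec set \<Rightarrow> bit vec \<Rightarrow> bit vec set set" where
  "shift_free D t = {B. B \<subseteq> D \<and> (\<forall>x\<in>B. t + x \<notin> B)}"

lemma finite_shift_free: "D \<subseteq> carrier_vec n \<Longrightarrow> finite (shift_free D t)"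
  using finite_subset_bit_vec[of D n] by (simp add: shift_free_def)

text \<open>Adding a nonzero \<open>t\<close> of the hyperplane is a fixed-point-free involution on
  each coset, which has \<open>N/2\<close> points. This gives \<open>3^(N/4)\<close> sets, and
  \<open>3 \<le> 2^(8/5)\<close> because \<open>3^5 = 243 \<le> 256 = 2^8\<close>.\<close>

lemma card_shift_free_le:
  assumes v: "v \<in> carrier_vec n" "v \<noteq> 0\<^sub>v n" and s: "s = 1 \<or> s = -1"
    and t: "t \<in> perp n v" "t \<noteq> 0\<^sub>v n"
  shows "real (card (shift_free {x \<in> carrier_vec n. chi v x = s} t)) \<le> 2 powr (2 / 5 * 2 ^ n)"
proof -
  let ?D = "{x \<in> carrier_vec n. chi v x = s}" and ?c = "real (card (shift_free {x \<in> carrier_vec n. chi v x = s} t))"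
  have tG: "t \<in> carrier_vec n" "chi v t = 1" using t by (auto simp: perp_eq_chi)
  have "t + x \<in> ?D \<and> t + x \<noteq> x \<and> t + (t + x) = x" if x: "x \<in> ?D" for x
  proof -
    have xG: "x \<in> carrier_vec n" "chi v x = s" using x by auto
    have "t + x \<noteq> x"
    proof
      assume "t + x = x"
      then have "x = t + x" by simp
      then have "t = x + x" using tG xG by (metis bit_vec_add_left_self comm_add_vec)
      then show False using t(2) bit_vec_add_self[OF xG(1)] by simp
    qed
    then show ?thesis
      using xG tG v chi_add[OF tG(1) xG(1) v(1)] by (auto simp: bit_vec_add_left_self)
  qed
  then have "(card (shift_free ?D t))\<^sup>2 \<le> 3 ^ card ?D"
    unfolding shift_free_def by (intro card_involution_free_le) auto
  then have "?c\<^sup>2 \<le> 3 ^ card ?D"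
    using of_nat_mono[where 'a = real] by fastforce
  also have "\<dots> = 3 powr (2 ^ n / 2)"
  proof -
    have "2 * real (card ?D) = 2 ^ n"
      using arg_cong[OF card_chi_eq[OF v s], of real] by simp
    then have "real (card ?D) = 2 ^ n / 2" by simp
    then show ?thesis by (metis powr_realpow zero_less_numeral)
  qed
  also have "\<dots> \<le> (2 powr (8 / 5)) powr (2 ^ n / 2)"
  proof (rule powr_mono2)
    have "(3 :: real) = (3 ^ 5) powr (1 / 5)" by (simp add: powr_powr flip: powr_numeral)
    also have "\<dots> \<le> (2 ^ 8) powr (1 / 5)" by (intro powr_mono2) auto
    also have "\<dots> = (2 powr 8) powr (1 / 5)" by simp
    also have "\<dots> = 2 powr (8 / 5)" by (simp only: powr_powr) simp
    finally show "(3 :: real) \<le> 2 powr (8 / 5)" .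
  qed auto
  also have "\<dots> = (2 powr (2 / 5 * 2 ^ n))\<^sup>2"
    by (simp add: powr_powr power2_eq_square flip: powr_add)
  finally show ?thesis by (rule power2_le_imp_le) simp
qed

text \<open>The factors count, from left to right: the normal vector \<open>v\<close>, the coset
  holding most of \<open>A\<close>, a missing \<open>t\<close> in the hyperplane, the few points of
  \<open>A\<close> in the other coset, and the shift-free rest.\<close>

lemma card_clustered_sumsets_le:
  assumes n: "0 < n"
  shows "real (card {A + A | A. A \<subseteq> carrier_vec n \<and> A \<noteq> {} \<and> A + A \<notin> perp_supersets n \<and>
      (\<exists>v\<in>carrier_vec n - {0\<^sub>v n}. \<exists>s\<in>{1, -1}. 32 * n * card {a \<in> A. chi v a = s} \<le> 2 ^ n)})
    \<le> 2 ^ n * (2 * (2 ^ n * (real ((2 ^ n + 1) ^ (2 ^ n div (32 * n))) * 2 powr (2 / 5 * 2 ^ n))))"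
    (is "real (card ?S) \<le> _")
proof -
  define small :: "bit vec set set" where "small = {B. B \<subseteq> carrier_vec n \<and> card B \<le> 2 ^ n div (32 * n)}"
  have fin_small: "finite small" by (simp add: small_def)
  have card_small: "real (card small) \<le> real ((2 ^ n + 1) ^ (2 ^ n div (32 * n)))"
    using card_small_subsets_le[of "carrier_vec n :: bit vec set" "2 ^ n div (32 * n)"]
    unfolding small_def card_bit_vec of_nat_le_iff by simp
  define V :: "bit vec set" where "V = carrier_vec n - {0\<^sub>v n}"
  define D where "D v s = {x \<in> carrier_vec n. chi v x = s}" for v s
  define X where "X v s t F = (\<lambda>B. (B \<union> F) + (B \<union> F)) ` shift_free (D v s) t" for v s t F
  let ?U = "\<Union>v\<in>V. \<Union>s\<in>{1, -1}. \<Union>t\<in>perp n v - {0\<^sub>v n}. \<Union>F\<in>small. X v s t F"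
  have cardV: "real (card V) \<le> 2 ^ n"
    using of_nat_mono[OF card_subset_bit_vec[of V n], where 'a = real] by (simp add: V_def)
  have perp: "real (card (perp n v - {0\<^sub>v n})) \<le> 2 ^ n" "finite (perp n v - {0\<^sub>v n})" for v
  proof -
    have "perp n v - {0\<^sub>v n} \<subseteq> carrier_vec n" by (auto simp: perp_def)
    then show "real (card (perp n v - {0\<^sub>v n})) \<le> 2 ^ n" "finite (perp n v - {0\<^sub>v n})"
      using of_nat_mono[OF card_subset_bit_vec, where 'a = real] finite_subset_bit_vec by (simp, blast)
  qed
  have finX: "finite (X v s t F)" for v s t F
    using finite_shift_free[of "D v s" n] by (auto simp: X_def D_def)
  have "?S \<subseteq> ?U"
  proof
    fix S assume "S \<in> ?S"
    then obtain A v s where A: "A \<subseteq> carrier_vec n" "S = A + A" "A \<noteq> {}" "A + A \<notin> perp_supersets n"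
      and v: "v \<in> V" and s: "s = 1 \<or> s = -1" and le: "32 * n * card {a \<in> A. chi v a = s} \<le> 2 ^ n"
      by (auto simp: V_def)
    \<comment> \<open>\<open>F\<close> is the small part. The bulk \<open>B\<close> lies in the
      opposite coset, so \<open>- s\<close> is the sign handed to \<open>X\<close>.\<close>
    define F where "F = {a \<in> A. chi v a = s}"
    define B where "B = {a \<in> A. chi v a = - s}"
    have vG: "v \<in> carrier_vec n" using v by (simp add: V_def)
    have AA: "A + A \<subseteq> carrier_vec n" using set_plus_closed_bit_vec[OF A(1) A(1)] .
    then obtain t where t: "t \<in> perp n v" "t \<notin> A + A"
      using A(4) vG by (auto simp: perp_supersets_def)
    have tG: "t \<in> carrier_vec n" using t by (simp add: perp_def)
    \<comment> \<open>\<open>A + A\<close> contains \<open>a + a = 0\<close>, as \<open>A\<close> is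
      nonempty; hence the missing \<open>t\<close> is not 0.\<close>
    have t0: "t \<noteq> 0\<^sub>v n"
    proof -
      obtain a where "a \<in> A" using A(3) by auto
      then have "0\<^sub>v n \<in> A + A" using A(1) bit_vec_add_self[of a n] set_plus_intro[of a A a A] by auto
      then show ?thesis using t by auto
    qed
    have "A = B \<union> F" using s chi_cases by (fastforce simp: B_def F_def)
    moreover have "F \<in> small"
      using le A(1) n by (auto simp: small_def F_def less_eq_div_iff_mult_less_eq mult.commute)
    moreover have "B \<in> shift_free (D v (- s)) t"
    proof -
      have "t + x \<notin> A" if x: "x \<in> A" for x
      proof
        assume "t + x \<in> A"
        then have "(t + x) + x \<in> A + A" using x by (rule set_plus_intro)
        moreover have "(t + x) + x = t"
          using x A(1) tG by (intro bit_vec_add_right_self) auto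
        ultimately show False using t(2) by simp
      qed
      then show ?thesis using A(1) by (auto simp: shift_free_def D_def B_def)
    qed
    ultimately have "S \<in> X v (- s) t F" by (auto simp: X_def A(2))
    moreover have "- s \<in> {1, -1}" using s by auto
    ultimately show "S \<in> ?U" using v t(1) t0 \<open>F \<in> small\<close> by blast
  qed
  then have "real (card ?S) \<le> real (card ?U)"
    using fin_small finX perp by (intro of_nat_mono card_mono) (auto simp: V_def)
  also have "\<dots> \<le> 2 ^ n * (2 * (2 ^ n * (real ((2 ^ n + 1) ^ (2 ^ n div (32 * n))) * 2 powr (2 / 5 * 2 ^ n))))"
  proof (intro card_UN_le_real fin_small card_small cardV perp)
    fix v s t F assume vst: "v \<in> V" "s \<in> {1, - 1 :: real}" "t \<in> perp n v - {0\<^sub>v n}"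
    have "card (X v s t F) \<le> card (shift_free (D v s) t)"
      unfolding X_def D_def by (rule card_image_le[OF finite_shift_free[of _ n]]) auto
    also have "real \<dots> \<le> 2 powr (2 / 5 * 2 ^ n)"
      unfolding D_def using vst n by (intro card_shift_free_le) (auto simp: V_def)
    finally show "real (card (X v s t F)) \<le> 2 powr (2 / 5 * 2 ^ n)" by simp
  qed (auto simp: V_def)
  finally show ?thesis .
qed

section \<open>Lower bound for the number of sumsets\<close>

text \<open>The map \<open>B \<mapsto> H \<union> B\<close> is injective on subsets of the
  complement \<open>D\<close> of \<open>H\<close>, and its values are sumsets outside an exceptional
  family. That family is small by the count of shift-free sets.\<close>

lemma card_sumsets_ge:
  assumes n: "0 < n"
  shows "2 powr (2 ^ n / 2) - (1 + 2 ^ n * 2 powr (2 / 5 * 2 ^ n)) \<le> real (card (sumsets n))"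
proof -
  let ?v = "unit_vec n 0 :: bit vec"
  have v: "?v \<in> carrier_vec n" "?v \<noteq> 0\<^sub>v n" using n by auto
  define D where "D = {x \<in> carrier_vec n. chi ?v x = -1}"
  define H where "H = perp n ?v"
  \<comment> \<open>The empty set is excluded because \<open>0\<close> lies in \<open>B + B\<close>
    only for nonempty \<open>B\<close>.\<close>
  define bad where "bad = {{}} \<union> (\<Union>t\<in>H - {0\<^sub>v n}. shift_free D t)"
  have H: "H \<subseteq> carrier_vec n" "H \<inter> D = {}" "0\<^sub>v n \<in> H"
    using v by (auto simp: H_def D_def perp_eq_chi)
  have DG: "D \<subseteq> carrier_vec n" by (auto simp: D_def)
  have fin: "finite H" "finite D" using H DG by (auto intro: finite_subset_bit_vec)
  have finbad: "finite bad" using fin finite_shift_free[OF DG] by (auto simp: bad_def)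
  have "real (card (H - {0\<^sub>v n})) \<le> 2 ^ n"
    using of_nat_mono[OF card_subset_bit_vec[of "H - {0\<^sub>v n}" n], where 'a = real] H by auto
  then have "real (card (\<Union>t\<in>H - {0\<^sub>v n}. shift_free D t)) \<le> 2 ^ n * 2 powr (2 / 5 * 2 ^ n)"
    using fin n v unfolding D_def H_def by (intro card_UN_le_real card_shift_free_le) auto
  then have cbad: "real (card bad) \<le> 1 + 2 ^ n * 2 powr (2 / 5 * 2 ^ n)"
    using of_nat_mono[OF card_Un_le[of "{{}}" "\<Union>t\<in>H - {0\<^sub>v n}. shift_free D t"], where 'a = real]
    by (simp add: bad_def)
  have cD: "real (card (Pow D)) = 2 powr (2 ^ n / 2)"
  proof -
    have "2 * real (card D) = 2 ^ n"
      using arg_cong[OF card_chi_eq[OF v, of "-1"], of real] by (simp add: D_def)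
    then have half: "2 ^ n / 2 = real (card D)" by simp
    show ?thesis unfolding half using fin by (simp add: card_Pow powr_realpow)
  qed
  have "(\<lambda>B. H \<union> B) ` (Pow D - bad) \<subseteq> sumsets n"
  proof
    fix S assume "S \<in> (\<lambda>B. H \<union> B) ` (Pow D - bad)"
    then obtain B where B: "B \<subseteq> D" "B \<notin> bad" "S = H \<union> B" by auto
    have BG: "B \<subseteq> carrier_vec n" using B DG by auto
    obtain b where b: "b \<in> B" using B(2) by (auto simp: bad_def)
    have "B + B \<subseteq> H"
    proof
      fix z assume "z \<in> B + B"
      then obtain x y where xy: "z = x + y" "x \<in> D" "y \<in> D" using B(1) by (auto simp: set_plus_def)
      then show "z \<in> H"
        using chi_add[of x n y ?v] v by (auto simp: D_def H_def perp_eq_chi intro!: add_carrier_vec)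
    qed
    moreover have "H \<subseteq> B + B"
    proof
      fix t assume t: "t \<in> H"
      show "t \<in> B + B"
      proof (cases "t = 0\<^sub>v n")
        case True
        then show ?thesis using b BG bit_vec_add_self[of b n] set_plus_intro[of b B b B] by auto
      next
        case False
        then have "B \<notin> shift_free D t" using B(2) t by (auto simp: bad_def)
        then obtain x where x: "x \<in> B" "t + x \<in> B" using B(1) by (auto simp: shift_free_def)
        have "(t + x) + x = t"
          using x BG t H by (intro bit_vec_add_right_self) auto
        then show ?thesis using set_plus_intro[OF x(2,1)] by simp
      qed
    qed
    ultimately have BB: "B + B = H" by auto
    let ?A = "insert (0\<^sub>v n) B"
    have "?A + ?A = H \<union> B"
    proof
      show "?A + ?A \<subseteq> H \<union> B"
      proof
        fix z assume "z \<in> ?A + ?A"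
        then obtain x y where xy: "z = x + y" "x \<in> ?A" "y \<in> ?A" by (rule set_plus_elim)
        have "x + y \<in> B + B" if "x \<in> B" "y \<in> B" using that by (rule set_plus_intro)
        then show "z \<in> H \<union> B" using xy BG BB H(3) by (auto simp: subset_iff)
      qed
      have "B \<subseteq> ?A + ?A"
      proof
        fix x assume "x \<in> B"
        then show "x \<in> ?A + ?A" using set_plus_intro[of "0\<^sub>v n" ?A x ?A] BG by auto
      qed
      moreover have "B + B \<subseteq> ?A + ?A" by (intro set_plus_mono2) auto
      ultimately show "H \<union> B \<subseteq> ?A + ?A" using BB by auto
    qed
    then have "S = ?A + ?A" "?A \<subseteq> carrier_vec n" using B(3) BG by auto
    then show "S \<in> sumsets n" unfolding sumsets_def by blast
  qed
  moreover have "finite (sumsets n)"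
  proof (rule finite_subset)
    show "sumsets n \<subseteq> Pow (carrier_vec n)"
      unfolding sumsets_def using set_plus_closed_bit_vec by blast
  qed simp
  ultimately have "card ((\<lambda>B. H \<union> B) ` (Pow D - bad)) \<le> card (sumsets n)"
    by (intro card_mono)
  moreover have "inj_on (\<lambda>B. H \<union> B) (Pow D - bad)" using H(2) by (intro inj_onI) blast
  moreover have "card (Pow D) - card bad \<le> card (Pow D - bad)"
    using finbad by (rule diff_card_le_card_Diff)
  ultimately have "real (card (Pow D)) - real (card bad) \<le> real (card (sumsets n))"
    by (simp add: card_image)
  then show ?thesis using cD cbad by linarith
qed

section \<open>Comparison of the exponents\<close>

lemma power_le_powr2:
  assumes "0 < n" and m: "real m \<le> c"
  shows "real ((2 ^ n + 1) ^ m) \<le> 2 powr (2 * real n * c)"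
proof -
  have "(2 :: real) ^ n + 1 \<le> 2 ^ n * 2 ^ n"
  proof -
    have "(2 :: real) \<le> 2 ^ n" using assms(1) self_le_power[of "2 :: real" n] by simp
    then show ?thesis using mult_right_mono[of 2 "2 ^ n" "2 ^ n :: real"] by linarith
  qed
  also have "\<dots> = 2 powr (2 * real n)"
    by (simp only: mult_2 powr_add powr_realpow zero_less_numeral)
  finally have "((2 :: real) ^ n + 1) ^ m \<le> (2 powr (2 * real n)) ^ m"
    by (intro power_mono) auto
  also have "\<dots> = 2 powr (2 * real n * real m)"
    by (simp add: powr_powr flip: powr_realpow)
  also have "\<dots> \<le> 2 powr (2 * real n * c)"
    using m by (intro powr_mono mult_left_mono) auto
  finally show ?thesis by (simp add: add.commute)
qed

text \<open>The size \<open>n^4\<close> of \<open>P\<close> balances two costs: choosing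
  \<open>P\<close> adds \<open>2 n^5\<close> to the exponent, choosing the fingerprint adds
  \<open>4096 N/n^2\<close>. For large \<open>n\<close> both are far below the saving
  \<open>N/(1024 n)\<close> from the containers.\<close>

lemma card_non_perp_sumsets_le:
  assumes n: "0 < n" and k: "64 * n * n ^ 4 \<le> 2 ^ n" "256 * n * (n + 1) \<le> n ^ 4"
  shows "real (card (sumsets n - perp_supersets n))
    \<le> 1 + 2 powr (2 * real n + 1 + 2 ^ n / 16 + 2 / 5 * 2 ^ n)
      + 2 powr (2 * real n ^ 5 + 4096 * 2 ^ n / real n ^ 2 + 1 + (1 / 2 - 1 / (1024 * real n)) * 2 ^ n)"
proof -
  let ?U = "{A + A | A. A \<subseteq> carrier_vec n \<and> A \<noteq> {} \<and> A + A \<notin> perp_supersets n \<and>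
      (\<exists>v\<in>carrier_vec n - {0\<^sub>v n}. \<exists>s\<in>{1, -1}. 32 * n * card {a \<in> A. chi v a = s} \<le> 2 ^ n)}"
  let ?W = "{A + A | A. A \<subseteq> carrier_vec n \<and> (\<forall>v\<in>carrier_vec n - {0\<^sub>v n}. \<forall>s\<in>{1, -1}.
      2 ^ n < 32 * n * card {a \<in> A. chi v a = s})}"
  have fin: "finite X" if "\<And>S. S \<in> X \<Longrightarrow> S \<subseteq> carrier_vec n" for X :: "bit vec set set"
    using that by (intro finite_subset[of X "Pow (carrier_vec n)"]) auto
  have "finite ?U" "finite ?W"
    by (rule fin, use set_plus_closed_bit_vec in blast)+
  \<comment> \<open>The empty sumset, from \<open>A = {}\<close>, is listed separately since the
    concentrated case assumes \<open>A \<noteq> {}\<close>; it gives the summand 1.\<close>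
  moreover have "sumsets n - perp_supersets n \<subseteq> {{}} \<union> ?U \<union> ?W"
  proof
    fix S assume S: "S \<in> sumsets n - perp_supersets n"
    then obtain A where A: "A \<subseteq> carrier_vec n" "S = A + A" by (auto simp: sumsets_def)
    show "S \<in> {{}} \<union> ?U \<union> ?W"
    proof (cases "A = {}")
      case True
      then show ?thesis using A by (simp add: set_plus_def)
    next
      case False
      show ?thesis
      proof (cases "\<exists>v\<in>carrier_vec n - {0\<^sub>v n}. \<exists>s\<in>{1, -1}. 32 * n * card {a \<in> A. chi v a = s} \<le> 2 ^ n")
        case True
        then have "S \<in> ?U" using A S False by blast
        then show ?thesis by blast
      next
        case False
        then have "S \<in> ?W" unfolding not_le[symmetric] using A by blast
        then show ?thesis by blast
      qed
    qed
  qed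
  ultimately have "card (sumsets n - perp_supersets n) \<le> card ({{}} \<union> ?U \<union> ?W)"
    by (intro card_mono) auto
  also have "\<dots> \<le> card {{} :: bit vec set} + card ?U + card ?W"
    by (intro order.trans[OF card_Un_le] add_right_mono card_Un_le)
  finally have "real (card (sumsets n - perp_supersets n)) \<le> 1 + real (card ?U) + real (card ?W)"
    using of_nat_mono[where 'a = real] by fastforce
  moreover have "real (card ?U) \<le> 2 powr (2 * real n + 1 + 2 ^ n / 16 + 2 / 5 * 2 ^ n)"
  proof -
    have "real (2 ^ n div (32 * n)) \<le> 2 ^ n / (32 * real n)"
      using of_nat_div_le_of_nat[of "2 ^ n" "32 * n", where 'a = real] by simp
    then have "real ((2 ^ n + 1) ^ (2 ^ n div (32 * n))) \<le> 2 powr (2 * real n * (2 ^ n / (32 * real n)))"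
      by (rule power_le_powr2[OF n])
    \<comment> \<open>The threshold \<open>N/(32 n)\<close> keeps this term below
      \<open>2^(N/2)\<close>, since \<open>1/16 + 2/5 < 1/2\<close>.\<close>
    also have "2 * real n * (2 ^ n / (32 * real n)) = 2 ^ n / 16" using n by simp
    finally have "real (card ?U) \<le> 2 ^ n * (2 * (2 ^ n * (2 powr (2 ^ n / 16) * 2 powr (2 / 5 * 2 ^ n))))"
      by (intro order.trans[OF card_clustered_sumsets_le[OF n]] mult_left_mono mult_right_mono) auto
    also have "\<dots> = 2 powr (real n + (1 + (real n + (2 ^ n / 16 + 2 / 5 * 2 ^ n))))"
      by (simp only: powr_add powr_realpow zero_less_numeral powr_one zero_le_numeral)
    also have "real n + (1 + (real n + (2 ^ n / 16 + 2 / 5 * 2 ^ n)))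
        = 2 * real n + 1 + 2 ^ n / 16 + 2 / 5 * 2 ^ n" by linarith
    finally show ?thesis .
  qed
  moreover have "real (card ?W)
    \<le> 2 powr (2 * real n ^ 5 + 4096 * 2 ^ n / real n ^ 2 + 1 + (1 / 2 - 1 / (1024 * real n)) * 2 ^ n)"
  proof -
    let ?c = "(1 / 2 - 1 / (1024 * real n)) * 2 ^ n"
    have pow: "real n ^ 3 = real n * real n ^ 2" "real n ^ 4 = real n * real n ^ 3" "real n ^ 5 = real n * real n ^ 4"
      by (simp_all flip: power_Suc)
    have "real (2048 * n * 2 ^ n div n ^ 4) \<le> real (2048 * n * 2 ^ n) / real (n ^ 4)"
      by (rule of_nat_div_le_of_nat)
    also have "\<dots> = 2048 * 2 ^ n / real n ^ 3" using n by (simp add: pow(2))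
    finally have "real ((2 ^ n + 1) ^ (2048 * n * 2 ^ n div n ^ 4)) \<le> 2 powr (2 * real n * (2048 * 2 ^ n / real n ^ 3))"
      by (rule power_le_powr2[OF n])
    also have "2 * real n * (2048 * 2 ^ n / real n ^ 3) = 4096 * 2 ^ n / real n ^ 2"
      using n by (simp add: pow(1))
    finally have 1: "real ((2 ^ n + 1) ^ (2048 * n * 2 ^ n div n ^ 4)) \<le> 2 powr (4096 * 2 ^ n / real n ^ 2)" .
    have "real ((2 ^ n + 1) ^ (n ^ 4)) \<le> 2 powr (2 * real n * real n ^ 4)"
      by (rule power_le_powr2[OF n]) simp
    also have "2 * real n * real n ^ 4 = 2 * real n ^ 5" by (simp add: pow(3))
    finally have 2: "real ((2 ^ n + 1) ^ (n ^ 4)) \<le> 2 powr (2 * real n ^ 5)" .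
    have "real (card ?W) \<le> real ((2 ^ n + 1) ^ (n ^ 4)) *
        (real ((2 ^ n + 1) ^ (2048 * n * 2 ^ n div n ^ 4)) * (2 * 2 powr ?c))"
      by (rule card_spread_sumsets_le[OF n k])
    also have "\<dots> \<le> 2 powr (2 * real n ^ 5) * (2 powr (4096 * 2 ^ n / real n ^ 2) * (2 * 2 powr ?c))"
      by (intro mult_mono 1 2) auto
    also have "\<dots> = 2 powr (2 * real n ^ 5 + 4096 * 2 ^ n / real n ^ 2 + 1 + ?c)"
      by (simp add: powr_add)
    finally show ?thesis .
  qed
  ultimately show ?thesis by linarith
qed

text \<open>The exponents of the upper bound stay below \<open>N/2\<close> by at least a constant
  times \<open>N/n\<close>, so a saving of \<open>sqrt N\<close> is affordable. Positivity of the
  count is recorded for the later division.\<close>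

lemma eventually_card_non_perp_sumsets_le:
  "\<forall>\<^sub>F n in sequentially. real (card (sumsets n - perp_supersets n))
    \<le> 2 powr (- sqrt (2 ^ n)) * real (card (sumsets n)) \<and> 0 < real (card (sumsets n))"
proof -
  have ev1: "\<forall>\<^sub>F n::nat in sequentially. 64 * real n * real n ^ 4 \<le> 2 ^ n"
    by real_asymp
  have ev2: "\<forall>\<^sub>F n::nat in sequentially. 256 * real n * (real n + 1) \<le> real n ^ 4"
    by real_asymp
  have ev3: "\<forall>\<^sub>F n::nat in sequentially. 0 \<le> (2 ^ n / 2 - sqrt (2 ^ n) - 3 :: real)"
    by real_asymp
  have ev4: "\<forall>\<^sub>F n::nat in sequentially.
      2 * real n + 1 + 2 ^ n / 16 + 2 / 5 * 2 ^ n \<le> 2 ^ n / 2 - sqrt (2 ^ n) - 3"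
    by real_asymp
  have ev5: "\<forall>\<^sub>F n::nat in sequentially.
      2 * real n ^ 5 + 4096 * 2 ^ n / real n ^ 2 + 1 + (1 / 2 - 1 / (1024 * real n)) * 2 ^ n
        \<le> 2 ^ n / 2 - sqrt (2 ^ n) - 3"
    by real_asymp
  show ?thesis
    using ev1 ev2 ev3 ev4 ev5 eventually_gt_at_top[of 0]
  proof eventually_elim
    case (elim n)
    \<comment> \<open>The \<open>- 3\<close> supplies a factor 1/8: the three summands of the upper
      bound cost at most 3/8, and the lower bound loses at most 2/8, so at least half of
      \<open>2^(N/2)\<close> remains.\<close>
    let ?E = "2 ^ n / 2 - sqrt (2 ^ n) - 3 :: real"
    have n: "0 < n" using elim by simp
    have k1: "64 * n * n ^ 4 \<le> 2 ^ n"
    proof -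
      have "real (64 * n * n ^ 4) \<le> real (2 ^ n)" using elim(1) by simp
      then show ?thesis by (simp only: of_nat_le_iff)
    qed
    have k2: "256 * n * (n + 1) \<le> n ^ 4"
    proof -
      have "real (256 * n * (n + 1)) \<le> real (n ^ 4)" using elim(2) by (simp add: algebra_simps)
      then show ?thesis by (simp only: of_nat_le_iff)
    qed
    have one: "1 \<le> 2 powr ?E" using elim(3) by (intro ge_one_powr_ge_zero) auto
    have c: "2 powr (2 * real n + 1 + 2 ^ n / 16 + 2 / 5 * 2 ^ n) \<le> 2 powr ?E"
      using elim(4) by (intro powr_mono) auto
    have d: "2 powr (2 * real n ^ 5 + 4096 * 2 ^ n / real n ^ 2 + 1 + (1 / 2 - 1 / (1024 * real n)) * 2 ^ n)
        \<le> 2 powr ?E"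
      using elim(5) by (intro powr_mono) auto
    have upper: "real (card (sumsets n - perp_supersets n)) \<le> 3 * 2 powr ?E"
      using card_non_perp_sumsets_le[OF n k1 k2] one c d by linarith
    have "2 ^ n * 2 powr (2 / 5 * 2 ^ n) = 2 powr (real n + 2 / 5 * 2 ^ n)"
      by (simp add: powr_add powr_realpow)
    also have "\<dots> \<le> 2 powr (2 * real n + 1 + 2 ^ n / 16 + 2 / 5 * 2 ^ n)"
    proof (intro powr_mono)
      have "(0 :: real) \<le> 2 ^ n / 16" by simp
      then show "real n + 2 / 5 * 2 ^ n \<le> 2 * real n + 1 + 2 ^ n / 16 + 2 / 5 * 2 ^ n" by linarith
    qed simp
    finally have "2 ^ n * 2 powr (2 / 5 * 2 ^ n) \<le> 2 powr ?E" using c by linarith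
    then have lower: "2 powr (2 ^ n / 2) - 2 * 2 powr ?E \<le> real (card (sumsets n))"
      using card_sumsets_ge[OF n] one by linarith
    have E: "2 powr ?E = 2 powr (- sqrt (2 ^ n)) * 2 powr (2 ^ n / 2) / 8"
    proof -
      have "?E = - sqrt (2 ^ n) + 2 ^ n / 2 + - 3" by simp
      then show ?thesis by (simp only: powr_add) (simp add: powr_minus)
    qed
    have "2 powr (- sqrt (2 ^ n)) \<le> 2 powr (0 :: real)" by (intro powr_mono) auto
    then have "2 powr ?E \<le> 2 powr (2 ^ n / 2) / 8"
      unfolding E by (simp add: mult_left_le_one_le)
    then have low: "2 powr (2 ^ n / 2) / 2 \<le> real (card (sumsets n))"
      using lower by linarith
    have "3 * 2 powr ?E \<le> 2 powr (- sqrt (2 ^ n)) * (2 powr (2 ^ n / 2) / 2)"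
      unfolding E by simp
    also have "\<dots> \<le> 2 powr (- sqrt (2 ^ n)) * real (card (sumsets n))"
      using low by (intro mult_left_mono) auto
    finally have "real (card (sumsets n - perp_supersets n)) \<le> 2 powr (- sqrt (2 ^ n)) * real (card (sumsets n))"
      using upper by linarith
    moreover have "(0::real) < 2 powr (2 ^ n / 2) / 2" by simp
    ultimately show ?case using low by linarith
  qed
qed

theorem theorem6p1:
  shows "(\<exists>C::real. C > 0 \<and>
           (\<forall>\<^sub>F n in sequentially.
              real (card (sumsets n - perp_supersets n))
                \<le> 2 powr (- (sqrt (2 ^ n) / 2 powr (C * sqrt (real n)))) * real (card (sumsets n))))
       \<and> (\<lambda>n. real (card (sumsets n - perp_supersets n))) \<in> o(\<lambda>n. real (card (sumsets n)))"
\<comment> \<open>\<open>C = 1\<close> serves because dividing \<open>sqrt N\<close> by a number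
  that is at least 1 only weakens the bound already obtained.\<close>
proof (intro conjI exI[of _ "1 :: real"])
  show "\<forall>\<^sub>F n in sequentially. real (card (sumsets n - perp_supersets n))
      \<le> 2 powr (- (sqrt (2 ^ n) / 2 powr (1 * sqrt (real n)))) * real (card (sumsets n))"
    using eventually_card_non_perp_sumsets_le
  proof eventually_elim
    case (elim n)
    have "(1 :: real) \<le> 2 powr (1 * sqrt (real n))" by (intro ge_one_powr_ge_zero) auto
    then have "sqrt (2 ^ n) / 2 powr (1 * sqrt (real n)) \<le> sqrt (2 ^ n) / 1"
      by (intro divide_left_mono) auto
    then have "2 powr (- sqrt (2 ^ n)) \<le> 2 powr (- (sqrt (2 ^ n) / 2 powr (1 * sqrt (real n))))"
      by (intro powr_mono) auto
    then show ?case
      using elim by (meson mult_right_mono of_nat_0_le_iff order_trans)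
  qed
  show "(\<lambda>n. real (card (sumsets n - perp_supersets n))) \<in> o(\<lambda>n. real (card (sumsets n)))"
  proof (rule smalloI_tendsto)
    show "\<forall>\<^sub>F n in sequentially. real (card (sumsets n)) \<noteq> 0"
      using eventually_card_non_perp_sumsets_le by eventually_elim simp
    show "(\<lambda>n. real (card (sumsets n - perp_supersets n)) / real (card (sumsets n))) \<longlonglongrightarrow> 0"
    proof (rule tendsto_sandwich[OF _ _ tendsto_const])
      show "(\<lambda>n::nat. 2 powr (- sqrt (2 ^ n)) :: real) \<longlonglongrightarrow> 0" by real_asymp
      show "\<forall>\<^sub>F n in sequentially. real (card (sumsets n - perp_supersets n)) / real (card (sumsets n))
          \<le> 2 powr (- sqrt (2 ^ n))"
        using eventually_card_non_perp_sumsets_le by eventually_elim (simp add: divide_le_eq)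
    qed auto
  qed
qed simp

end
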